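(* In the binary random graph affiliation mixture model with $Q\ge 1$ groups, uniform group priors $\pi_q=1/Q$, and $\alpha\ne\beta$, let $m_1=\mathbb E(X_{12})$, $m_{31}=\mathbb E(X_{12}X_{13}X_{23})$, $m_{41}=\mathbb E(X_{12}X_{23}X_{34}X_{14})$. Then $m_{41}\neq m_1^4$ when $Q\ge2$, and for every $Q\ge2$ $$Q=\frac{-m_{31}^4-m_{41}^3-3m_{41}m_1^8+3m_{41}^2m_1^4-6m_1^6m_{31}^2+4m_1^9m_{31}+4m_1^3m_{31}^3}{(m_1^4-m_{41})^3}.$$
   Context: Random graph mixture model: nodes have i.i.d. latent groups $Z_i\in\{1,\dots,Q\}$ with $\pi_q=\mathbb P(Z_i=q)$; edge variables $X_{ij}$ ($i<j$) are conditionally independent given all $Z$'s, with law of $X_{ij}$ depending only on $(Z_i,Z_j)$. Binary affiliation model: $X_{ij}\in\{0,1\}$ with $\mathbb P(X_{ij}=1\mid Z_i=q,Z_j=l)=\alpha$ if $q=l$ and $=\beta$ if $q\ne l$. *)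

theory Defs
  imports "HOL-Probability.Probability"
begin

text \<open>The pmf is over the edge-indicator function x :: nat * nat => bool
  (x (i,j) = X_ij for 1 <= i < j <= n).\<close>

definition node_pairs :: "nat \<Rightarrow> (nat \<times> nat) set" where
  "node_pairs n = {(i, j). 1 \<le> i \<and> i < j \<and> j \<le> n}"

definition latent_groups :: "nat \<Rightarrow> nat \<Rightarrow> (nat \<Rightarrow> nat) pmf" where
  "latent_groups n Q = Pi_pmf {1..n} 0 (\<lambda>_. pmf_of_set {1..Q})"

definition affiliation_graph :: "nat \<Rightarrow> nat \<Rightarrow> real \<Rightarrow> real \<Rightarrow> (nat \<times> nat \<Rightarrow> bool) pmf" where
  "affiliation_graph n Q \<alpha> \<beta> =
     bind_pmf (latent_groups n Q) (\<lambda>z.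
       Pi_pmf (node_pairs n) False
         (\<lambda>(i, j). bernoulli_pmf (if z i = z j then \<alpha> else \<beta>)))"

definition edge_moment :: "nat \<Rightarrow> nat \<Rightarrow> real \<Rightarrow> real \<Rightarrow> (nat \<times> nat) list \<Rightarrow> real" where
  "edge_moment n Q \<alpha> \<beta> E =
     measure_pmf.expectation (affiliation_graph n Q \<alpha> \<beta>)
       (\<lambda>x. \<Prod>e\<leftarrow>E. (if x e then 1 else 0))"

end

theory Submission
  imports Defs
begin

text \<open>
  Conditionally on the latent groups the edge indicators are independent
  Bernoulli variables, so the moment of a pattern of distinct edges is the expectation,
  over the i.i.d. uniform groups, of the product of the connection probabilities
  \<open>w(a,b) = (if a = b then \<alpha> else \<beta>)\<close>.  All three patterns live on nodes 1..4, so their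
  moments can be computed in the four-node model as explicit finite sums over groups.
  With \<open>d = \<alpha> - \<beta>\<close>, the identities \<open>\<Sum>\<^sub>b w(a,b) = Q\<beta> + d\<close> and
  \<open>\<Sum>\<^sub>b w(a,b) w(b,c) = Q\<beta>\<^sup>2 + 2\<beta>d + [a = c] d\<^sup>2\<close> give
  \<open>m1 = \<beta> + d/Q\<close>, \<open>m31 = m1\<^sup>3 + A\<close> and \<open>m41 = m1\<^sup>4 + B\<close>, where
  \<open>A = (Q - 1) d\<^sup>3/Q\<^sup>3\<close> and \<open>B = (Q - 1) d\<^sup>4/Q\<^sup>4\<close>.  These satisfy \<open>A\<^sup>4 = (Q - 1) B\<^sup>3\<close>, and
  \<open>B \<noteq> 0\<close> once \<open>Q \<ge> 2\<close> and \<open>\<alpha> \<noteq> \<beta>\<close>; a purely algebraic inversion then recovers \<open>Q\<close>.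
\<close>

lemma expectation_bind_pmf_finite:
  fixes h :: "'b \<Rightarrow> real"
  assumes "finite (set_pmf p)" "\<And>x. x \<in> set_pmf p \<Longrightarrow> finite (set_pmf (f x))"
  shows "measure_pmf.expectation (bind_pmf p f) h =
         measure_pmf.expectation p (\<lambda>x. measure_pmf.expectation (f x) h)"
proof -
  have "measure_pmf.expectation p (\<lambda>x. measure_pmf.expectation (f x) h) =
        (\<Sum>x\<in>set_pmf p. pmf p x *\<^sub>R measure_pmf.expectation (f x) h)"
    by (rule integral_measure_pmf) (use assms in auto)
  then show ?thesis
    using assms by (simp add: pmf_expectation_bind[of "set_pmf p"])
qed

lemma finite_set_Pi_pmf:
  assumes "finite A" "\<And>x. x \<in> A \<Longrightarrow> finite (set_pmf (p x))"
  shows "finite (set_pmf (Pi_pmf A dflt p))"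
  using assms by (simp add: set_Pi_pmf finite_PiE_dflt)

lemma expectation_Pi_pmf_insert:
  fixes h :: "('a \<Rightarrow> 'b) \<Rightarrow> real"
  assumes "finite A" "x \<notin> A" "\<And>i. finite (set_pmf (p i))"
  shows "measure_pmf.expectation (Pi_pmf (insert x A) dflt p) h =
         measure_pmf.expectation (p x)
           (\<lambda>y. measure_pmf.expectation (Pi_pmf A dflt p) (\<lambda>f. h (f(x := y))))"
  using assms by (simp add: Pi_pmf_insert' expectation_bind_pmf_finite finite_set_Pi_pmf)

lemma expectation_Pi_pmf_four:
  fixes h :: "(nat \<Rightarrow> 'b) \<Rightarrow> real"
  assumes "finite (set_pmf p)"
  shows "measure_pmf.expectation (Pi_pmf {1..4} dflt (\<lambda>_. p)) h =
    measure_pmf.expectation p (\<lambda>a. measure_pmf.expectation p (\<lambda>b.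
    measure_pmf.expectation p (\<lambda>c. measure_pmf.expectation p (\<lambda>d.
      h ((\<lambda>_. dflt)(4 := d, 3 := c, 2 := b, 1 := a))))))"
proof -
  have "{1..4::nat} = insert 1 (insert 2 (insert 3 (insert 4 {})))" by auto
  then show ?thesis using assms by (simp add: expectation_Pi_pmf_insert)
qed

lemma expectation_Pi_bernoulli_edges:
  fixes A :: "'a set" and E :: "'a list"
  assumes "finite A" "distinct E" "set E \<subseteq> A" "\<And>e. 0 \<le> r e" "\<And>e. r e \<le> 1"
  shows "measure_pmf.expectation (Pi_pmf A False (\<lambda>e. bernoulli_pmf (r e)))
           (\<lambda>x. \<Prod>e\<leftarrow>E. if x e then 1 else 0) = (\<Prod>e\<leftarrow>E. r e)"
proof -
  define f where "f e v = (if e \<in> set E \<and> \<not> v then 0 else (1::real))" for e v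
  have indicator_prod: "(\<Prod>e\<leftarrow>E. if x e then 1 else 0) = (\<Prod>e\<in>A. f e (x e))" for x :: "'a \<Rightarrow> bool"
  proof -
    have "(\<Prod>e\<leftarrow>E. if x e then 1 else 0) = (\<Prod>e\<in>set E. if x e then 1 else (0::real))"
      using assms(2) by (simp add: prod.distinct_set_conv_list)
    also have "\<dots> = (\<Prod>e\<in>A. f e (x e))"
      using assms(1,3) by (intro prod.mono_neutral_cong_left) (auto simp: f_def)
    finally show ?thesis .
  qed
  have "measure_pmf.expectation (Pi_pmf A False (\<lambda>e. bernoulli_pmf (r e)))
          (\<lambda>x. \<Prod>e\<in>A. f e (x e))
        = (\<Prod>e\<in>A. measure_pmf.expectation (bernoulli_pmf (r e)) (f e))"
    by (rule expectation_prod_Pi_pmf[OF assms(1)]) (auto intro!: integrable_measure_pmf_finite simp: f_def)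
  also have "\<dots> = (\<Prod>e\<in>set E. r e)"
    using assms by (intro prod.mono_neutral_cong_right) (auto simp: f_def)
  also have "\<dots> = (\<Prod>e\<leftarrow>E. r e)"
    using assms(2) by (simp add: prod.distinct_set_conv_list)
  finally show ?thesis by (simp add: indicator_prod)
qed

definition group_link :: "real \<Rightarrow> real \<Rightarrow> nat \<Rightarrow> nat \<Rightarrow> real" where
  "group_link \<alpha> \<beta> a b = (if a = b then \<alpha> else \<beta>)"

definition link_prob :: "real \<Rightarrow> real \<Rightarrow> (nat \<Rightarrow> nat) \<Rightarrow> nat \<times> nat \<Rightarrow> real" where
  "link_prob \<alpha> \<beta> z e = group_link \<alpha> \<beta> (z (fst e)) (z (snd e))"

lemma finite_node_pairs: "finite (node_pairs n)"
  by (rule finite_subset[of _ "{1..n} \<times> {1..n}"]) (auto simp: node_pairs_def)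

lemma finite_set_latent_groups: "Q \<ge> 1 \<Longrightarrow> finite (set_pmf (latent_groups n Q))"
  unfolding latent_groups_def by (intro finite_set_Pi_pmf) auto

lemma edge_moment_latent:
  assumes "Q \<ge> 1" "0 \<le> \<alpha>" "\<alpha> \<le> 1" "0 \<le> \<beta>" "\<beta> \<le> 1"
    and "distinct E" "set E \<subseteq> node_pairs n"
  shows "edge_moment n Q \<alpha> \<beta> E =
         measure_pmf.expectation (latent_groups n Q) (\<lambda>z. \<Prod>e\<leftarrow>E. link_prob \<alpha> \<beta> z e)"
proof -
  have graph: "affiliation_graph n Q \<alpha> \<beta> = latent_groups n Q \<bind>
      (\<lambda>z. Pi_pmf (node_pairs n) False (\<lambda>e. bernoulli_pmf (link_prob \<alpha> \<beta> z e)))"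
    unfolding affiliation_graph_def link_prob_def group_link_def by (simp add: case_prod_beta')
  have finite_edges: "finite (set_pmf (Pi_pmf (node_pairs n) False (\<lambda>e. bernoulli_pmf (r e))))"
    for r :: "nat \<times> nat \<Rightarrow> real"
    by (intro finite_set_Pi_pmf finite_node_pairs) (simp add: set_pmf_bernoulli)
  have link_bounds: "0 \<le> link_prob \<alpha> \<beta> z e" "link_prob \<alpha> \<beta> z e \<le> 1" for z e
    using assms(2-5) by (auto simp: link_prob_def group_link_def)
  have "edge_moment n Q \<alpha> \<beta> E = measure_pmf.expectation (latent_groups n Q) (\<lambda>z.
          measure_pmf.expectation (Pi_pmf (node_pairs n) False (\<lambda>e. bernoulli_pmf (link_prob \<alpha> \<beta> z e)))
            (\<lambda>x. \<Prod>e\<leftarrow>E. if x e then 1 else 0))"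
    unfolding edge_moment_def graph using assms(1)
    by (intro expectation_bind_pmf_finite finite_set_latent_groups finite_edges)
  also have "\<dots> = measure_pmf.expectation (latent_groups n Q) (\<lambda>z. \<Prod>e\<leftarrow>E. link_prob \<alpha> \<beta> z e)"
    using assms(6,7) link_bounds
    by (intro Bochner_Integration.integral_cong refl expectation_Pi_bernoulli_edges finite_node_pairs)
  finally show ?thesis .
qed

text \<open>Moments of a pattern on nodes \<open>1..m\<close> do not depend on the total number \<open>n \<ge> m\<close> of
  nodes, because the groups of the other nodes are integrated out.\<close>
lemma edge_moment_restrict:
  assumes "m \<le> n" "Q \<ge> 1" "0 \<le> \<alpha>" "\<alpha> \<le> 1" "0 \<le> \<beta>" "\<beta> \<le> 1"
    and "distinct E" "set E \<subseteq> node_pairs m"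
  shows "edge_moment n Q \<alpha> \<beta> E = edge_moment m Q \<alpha> \<beta> E"
proof -
  define restrict :: "(nat \<Rightarrow> nat) \<Rightarrow> nat \<Rightarrow> nat" where
    "restrict z x = (if x \<in> {1..m} then z x else 0)" for z x
  have "node_pairs m \<subseteq> node_pairs n" using assms(1) by (auto simp: node_pairs_def)
  then have E_n: "set E \<subseteq> node_pairs n" using assms(8) by blast
  have latent: "latent_groups m Q = map_pmf restrict (latent_groups n Q)"
    unfolding latent_groups_def restrict_def using assms(1) by (intro Pi_pmf_subset) auto
  have restrict_invariant: "(\<Prod>e\<leftarrow>E. link_prob \<alpha> \<beta> z e) = (\<Prod>e\<leftarrow>E. link_prob \<alpha> \<beta> (restrict z) e)" for z
    using assms(8) by (intro arg_cong[where f = prod_list] map_cong refl)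
      (auto simp: link_prob_def node_pairs_def restrict_def)
  have "edge_moment n Q \<alpha> \<beta> E = measure_pmf.expectation (latent_groups n Q)
          (\<lambda>z. \<Prod>e\<leftarrow>E. link_prob \<alpha> \<beta> (restrict z) e)"
    using assms E_n by (subst edge_moment_latent) (auto intro: Bochner_Integration.integral_cong restrict_invariant)
  also have "\<dots> = edge_moment m Q \<alpha> \<beta> E"
    using assms by (simp add: edge_moment_latent latent)
  finally show ?thesis .
qed

lemma sum_group_link:
  fixes \<alpha> \<beta> :: real
  assumes "finite S" "a \<in> S"
  shows "(\<Sum>b\<in>S. group_link \<alpha> \<beta> a b) = card S * \<beta> + (\<alpha> - \<beta>)"
proof -
  have "(\<Sum>b\<in>S. group_link \<alpha> \<beta> a b) = (\<Sum>b\<in>S. \<beta> + (if a = b then \<alpha> - \<beta> else 0))"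
    by (intro sum.cong) (auto simp: group_link_def)
  also have "\<dots> = card S * \<beta> + (\<alpha> - \<beta>)" using assms by (simp add: sum.distrib)
  finally show ?thesis .
qed

lemma sum_group_link_path:
  fixes \<alpha> \<beta> :: real
  assumes "finite S" "a \<in> S" "c \<in> S"
  shows "(\<Sum>b\<in>S. group_link \<alpha> \<beta> a b * group_link \<alpha> \<beta> b c) =
    card S * \<beta>\<^sup>2 + 2 * \<beta> * (\<alpha> - \<beta>) + (if a = c then (\<alpha> - \<beta>)\<^sup>2 else 0)"
proof -
  have "(\<Sum>b\<in>S. group_link \<alpha> \<beta> a b * group_link \<alpha> \<beta> b c) =
     (\<Sum>b\<in>S. \<beta>\<^sup>2 + (if a = b then \<beta> * (\<alpha> - \<beta>) else 0) + (if c = b then \<beta> * (\<alpha> - \<beta>) else 0)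
        + (if a = b then if c = b then (\<alpha> - \<beta>)\<^sup>2 else 0 else 0))"
    by (intro sum.cong) (auto simp: group_link_def power2_eq_square algebra_simps)
  also have "\<dots> = card S * \<beta>\<^sup>2 + 2 * \<beta> * (\<alpha> - \<beta>) + (if a = c then (\<alpha> - \<beta>)\<^sup>2 else 0)"
    using assms by (simp add: sum.distrib)
  finally show ?thesis .
qed

lemma edge_moment_four_nodes:
  assumes "Q \<ge> 1" "0 \<le> \<alpha>" "\<alpha> \<le> 1" "0 \<le> \<beta>" "\<beta> \<le> 1"
    and "distinct E" "set E \<subseteq> node_pairs 4"
  shows "edge_moment 4 Q \<alpha> \<beta> E =
    (\<Sum>a=1..Q. \<Sum>b=1..Q. \<Sum>c=1..Q. \<Sum>d=1..Q.
       \<Prod>e\<leftarrow>E. link_prob \<alpha> \<beta> ((\<lambda>_. 0)(4 := d, 3 := c, 2 := b, 1 := a)) e) / real Q ^ 4"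
proof -
  have "edge_moment 4 Q \<alpha> \<beta> E = measure_pmf.expectation (Pi_pmf {1..4} 0 (\<lambda>_. pmf_of_set {1..Q}))
          (\<lambda>z. \<Prod>e\<leftarrow>E. link_prob \<alpha> \<beta> z e)"
    using assms by (simp only: edge_moment_latent latent_groups_def)
  also have "\<dots> = (\<Sum>a=1..Q. \<Sum>b=1..Q. \<Sum>c=1..Q. \<Sum>d=1..Q.
       \<Prod>e\<leftarrow>E. link_prob \<alpha> \<beta> ((\<lambda>_. 0)(4 := d, 3 := c, 2 := b, 1 := a)) e) / real Q ^ 4"
    using assms(1) by (subst expectation_Pi_pmf_four)
      (simp_all add: integral_pmf_of_set sum_divide_distrib power4_eq_xxxx)
  finally show ?thesis .
qed

lemma group_link_sym: "group_link \<alpha> \<beta> a b = group_link \<alpha> \<beta> b a"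
  by (auto simp: group_link_def)

lemma edge_moment_single:
  fixes \<alpha> \<beta> :: real
  assumes "Q \<ge> 1" "0 \<le> \<alpha>" "\<alpha> \<le> 1" "0 \<le> \<beta>" "\<beta> \<le> 1"
  shows "edge_moment 4 Q \<alpha> \<beta> [(1,2)] = \<beta> + (\<alpha> - \<beta>) / Q"
proof -
  have "edge_moment 4 Q \<alpha> \<beta> [(1,2)] = real Q ^ 2 * (\<Sum>a=1..Q. \<Sum>b=1..Q. group_link \<alpha> \<beta> a b) / real Q ^ 4"
    using assms by (simp add: edge_moment_four_nodes node_pairs_def link_prob_def
        sum_distrib_left power2_eq_square mult.assoc)
  also have "\<dots> = real Q ^ 2 * (Q * (Q * \<beta> + (\<alpha> - \<beta>))) / real Q ^ 4"
    by (simp add: sum_group_link)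
  also have "\<dots> = \<beta> + (\<alpha> - \<beta>) / Q"
    using assms(1) by (simp add: field_simps power_numeral_reduce)
  finally show ?thesis .
qed

text \<open>The triangle moment \<open>m31\<close>: summing out the third node leaves the two-step path sum.\<close>
lemma edge_moment_triangle:
  fixes \<alpha> \<beta> :: real
  assumes "Q \<ge> 1" "0 \<le> \<alpha>" "\<alpha> \<le> 1" "0 \<le> \<beta>" "\<beta> \<le> 1"
  shows "edge_moment 4 Q \<alpha> \<beta> [(1,2), (1,3), (2,3)] =
    (\<beta> + (\<alpha> - \<beta>) / Q) ^ 3 + (real Q - 1) * (\<alpha> - \<beta>) ^ 3 / real Q ^ 3"
proof -
  define u where "u = Q * \<beta>\<^sup>2 + 2 * \<beta> * (\<alpha> - \<beta>)"
  have two_step: "(\<Sum>c=1..Q. group_link \<alpha> \<beta> a c * group_link \<alpha> \<beta> c b) =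
      u + (if a = b then (\<alpha> - \<beta>)\<^sup>2 else 0)" if "a \<in> {1..Q}" "b \<in> {1..Q}" for a b
    using that by (simp add: sum_group_link_path u_def)
  have "edge_moment 4 Q \<alpha> \<beta> [(1,2), (1,3), (2,3)] =
      Q * (\<Sum>a=1..Q. \<Sum>b=1..Q. group_link \<alpha> \<beta> a b *
        (\<Sum>c=1..Q. group_link \<alpha> \<beta> a c * group_link \<alpha> \<beta> c b)) / real Q ^ 4"
    using assms by (simp add: edge_moment_four_nodes node_pairs_def link_prob_def
        sum_distrib_left group_link_sym mult.left_commute)
  also have "(\<Sum>a=1..Q. \<Sum>b=1..Q. group_link \<alpha> \<beta> a b *
        (\<Sum>c=1..Q. group_link \<alpha> \<beta> a c * group_link \<alpha> \<beta> c b)) =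
      (\<Sum>a=1..Q. \<Sum>b=1..Q. group_link \<alpha> \<beta> a b * (u + (if a = b then (\<alpha> - \<beta>)\<^sup>2 else 0)))"
    by (intro sum.cong refl arg_cong2[where f = "(*)"] two_step) auto
  also have "\<dots> = (\<Sum>a=1..Q. \<Sum>b=1..Q. u * group_link \<alpha> \<beta> a b
        + (if a = b then \<alpha> * (\<alpha> - \<beta>)\<^sup>2 else 0))"
    by (intro sum.cong refl) (auto simp: distrib_left group_link_def mult.commute)
  also have "\<dots> = Q * (u * (Q * \<beta> + (\<alpha> - \<beta>)) + \<alpha> * (\<alpha> - \<beta>)\<^sup>2)"
    by (simp add: sum.distrib sum_group_link flip: sum_distrib_left)
  also have "Q * (Q * (u * (Q * \<beta> + (\<alpha> - \<beta>)) + \<alpha> * (\<alpha> - \<beta>)\<^sup>2)) / real Q ^ 4 =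
      (\<beta> + (\<alpha> - \<beta>) / Q) ^ 3 + (real Q - 1) * (\<alpha> - \<beta>) ^ 3 / real Q ^ 3"
    using assms(1) by (simp add: u_def field_simps power_numeral_reduce)
  finally show ?thesis .
qed

lemma sum_four_cycle:
  fixes \<alpha> \<beta> :: real
  shows "(\<Sum>a\<in>S. \<Sum>b\<in>S. \<Sum>c\<in>S. \<Sum>d\<in>S.
      group_link \<alpha> \<beta> a b * (group_link \<alpha> \<beta> b c * (group_link \<alpha> \<beta> c d * group_link \<alpha> \<beta> a d))) =
    (\<Sum>a\<in>S. \<Sum>c\<in>S. (\<Sum>b\<in>S. group_link \<alpha> \<beta> a b * group_link \<alpha> \<beta> b c)\<^sup>2)"
proof -
  have "(\<Sum>a\<in>S. \<Sum>c\<in>S. (\<Sum>b\<in>S. group_link \<alpha> \<beta> a b * group_link \<alpha> \<beta> b c)\<^sup>2) =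
      (\<Sum>a\<in>S. \<Sum>c\<in>S. \<Sum>b\<in>S. \<Sum>d\<in>S.
        group_link \<alpha> \<beta> a b * group_link \<alpha> \<beta> b c * (group_link \<alpha> \<beta> a d * group_link \<alpha> \<beta> d c))"
    by (simp add: power2_eq_square sum_product)
  also have "\<dots> = (\<Sum>a\<in>S. \<Sum>b\<in>S. \<Sum>c\<in>S. \<Sum>d\<in>S.
        group_link \<alpha> \<beta> a b * group_link \<alpha> \<beta> b c * (group_link \<alpha> \<beta> a d * group_link \<alpha> \<beta> d c))"
    by (intro sum.cong refl sum.swap)
  also have "\<dots> = (\<Sum>a\<in>S. \<Sum>b\<in>S. \<Sum>c\<in>S. \<Sum>d\<in>S.
      group_link \<alpha> \<beta> a b * (group_link \<alpha> \<beta> b c * (group_link \<alpha> \<beta> c d * group_link \<alpha> \<beta> a d)))"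
    by (intro sum.cong refl) (metis group_link_sym mult.assoc mult.commute)
  finally show ?thesis ..
qed

lemma edge_moment_square:
  fixes \<alpha> \<beta> :: real
  assumes "Q \<ge> 1" "0 \<le> \<alpha>" "\<alpha> \<le> 1" "0 \<le> \<beta>" "\<beta> \<le> 1"
  shows "edge_moment 4 Q \<alpha> \<beta> [(1,2), (2,3), (3,4), (1,4)] =
    (\<beta> + (\<alpha> - \<beta>) / Q) ^ 4 + (real Q - 1) * (\<alpha> - \<beta>) ^ 4 / real Q ^ 4"
proof -
  define u where "u = Q * \<beta>\<^sup>2 + 2 * \<beta> * (\<alpha> - \<beta>)"
  have two_step: "(\<Sum>b=1..Q. group_link \<alpha> \<beta> a b * group_link \<alpha> \<beta> b c) =
      u + (if a = c then (\<alpha> - \<beta>)\<^sup>2 else 0)" if "a \<in> {1..Q}" "c \<in> {1..Q}" for a c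
    using that by (simp add: sum_group_link_path u_def)
  have "edge_moment 4 Q \<alpha> \<beta> [(1,2), (2,3), (3,4), (1,4)] =
      (\<Sum>a=1..Q. \<Sum>b=1..Q. \<Sum>c=1..Q. \<Sum>d=1..Q. group_link \<alpha> \<beta> a b *
        (group_link \<alpha> \<beta> b c * (group_link \<alpha> \<beta> c d * group_link \<alpha> \<beta> a d))) / real Q ^ 4"
    using assms by (simp add: edge_moment_four_nodes node_pairs_def link_prob_def)
  also have "\<dots> = (\<Sum>a=1..Q. \<Sum>c=1..Q.
      (\<Sum>b=1..Q. group_link \<alpha> \<beta> a b * group_link \<alpha> \<beta> b c)\<^sup>2) / real Q ^ 4"
    by (simp only: sum_four_cycle)
  also have "(\<Sum>a=1..Q. \<Sum>c=1..Q. (\<Sum>b=1..Q. group_link \<alpha> \<beta> a b * group_link \<alpha> \<beta> b c)\<^sup>2) =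
      (\<Sum>a=1..Q. \<Sum>c=1..Q. (u + (if a = c then (\<alpha> - \<beta>)\<^sup>2 else 0))\<^sup>2)"
    by (intro sum.cong refl arg_cong[where f = "\<lambda>x. x\<^sup>2"] two_step) auto
  also have "\<dots> = (\<Sum>a=1..Q. \<Sum>c=1..Q. u\<^sup>2
      + (if a = c then 2 * u * (\<alpha> - \<beta>)\<^sup>2 + (\<alpha> - \<beta>) ^ 4 else 0))"
    by (intro sum.cong refl) (auto simp: power2_eq_square power4_eq_xxxx algebra_simps)
  also have "\<dots> = Q * (Q * u\<^sup>2 + (2 * u * (\<alpha> - \<beta>)\<^sup>2 + (\<alpha> - \<beta>) ^ 4))"
    by (simp add: sum.distrib)
  also have "Q * (Q * u\<^sup>2 + (2 * u * (\<alpha> - \<beta>)\<^sup>2 + (\<alpha> - \<beta>) ^ 4)) / real Q ^ 4 =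
      (\<beta> + (\<alpha> - \<beta>) / Q) ^ 4 + (real Q - 1) * (\<alpha> - \<beta>) ^ 4 / real Q ^ 4"
    using assms(1) by (simp add: u_def field_simps power_numeral_reduce)
  finally show ?thesis .
qed

lemma excess_relation:
  fixes q d :: real
  shows "((q - 1) * d ^ 3 / q ^ 3) ^ 4 = (q - 1) * ((q - 1) * d ^ 4 / q ^ 4) ^ 3"
proof -
  have "((q - 1) * d ^ 3 / q ^ 3) ^ 4 = (q - 1) ^ 4 * d ^ 12 / q ^ 12"
    by (simp add: power_divide power_mult_distrib flip: power_mult)
  also have "\<dots> = (q - 1) * ((q - 1) * d ^ 4 / q ^ 4) ^ 3"
    by (simp add: power_divide power_mult_distrib flip: power_mult power_Suc)
  finally show ?thesis .
qed

lemma moment_inversion: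
  fixes q m1 m31 m41 A B :: real
  assumes "m31 = m1 ^ 3 + A" "m41 = m1 ^ 4 + B" "A ^ 4 = (q - 1) * B ^ 3" "B \<noteq> 0"
  shows "m41 \<noteq> m1 ^ 4"
    and "q = (- (m31 ^ 4) - m41 ^ 3 - 3 * m41 * m1 ^ 8 + 3 * m41 ^ 2 * m1 ^ 4
              - 6 * m1 ^ 6 * m31 ^ 2 + 4 * m1 ^ 9 * m31 + 4 * m1 ^ 3 * m31 ^ 3)
             / (m1 ^ 4 - m41) ^ 3"
proof -
  show "m41 \<noteq> m1 ^ 4" using assms(2,4) by simp
  have numerator: "- (m31 ^ 4) - m41 ^ 3 - 3 * m41 * m1 ^ 8 + 3 * m41 ^ 2 * m1 ^ 4
      - 6 * m1 ^ 6 * m31 ^ 2 + 4 * m1 ^ 9 * m31 + 4 * m1 ^ 3 * m31 ^ 3 = - (A ^ 4) - B ^ 3"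
    unfolding assms(1,2) by algebra
  have denominator: "(m1 ^ 4 - m41) ^ 3 = - (B ^ 3)"
    unfolding assms(2) by algebra
  show "q = (- (m31 ^ 4) - m41 ^ 3 - 3 * m41 * m1 ^ 8 + 3 * m41 ^ 2 * m1 ^ 4
              - 6 * m1 ^ 6 * m31 ^ 2 + 4 * m1 ^ 9 * m31 + 4 * m1 ^ 3 * m31 ^ 3)
             / (m1 ^ 4 - m41) ^ 3"
    unfolding numerator denominator using assms(3,4) by (simp add: field_simps)
qed

theorem proposition4:
  fixes n Q :: nat and \<alpha> \<beta> m1 m31 m41 :: real
  assumes "n \<ge> 4" and "Q \<ge> 1"
    and "0 \<le> \<alpha>" "\<alpha> \<le> 1" "0 \<le> \<beta>" "\<beta> \<le> 1" and "\<alpha> \<noteq> \<beta>"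
    and "m1 = edge_moment n Q \<alpha> \<beta> [(1,2)]"
    and "m31 = edge_moment n Q \<alpha> \<beta> [(1,2), (1,3), (2,3)]"
    and "m41 = edge_moment n Q \<alpha> \<beta> [(1,2), (2,3), (3,4), (1,4)]"
  shows "Q \<ge> 2 \<longrightarrow>
           m41 \<noteq> m1 ^ 4 \<and>
           real Q = (- (m31 ^ 4) - m41 ^ 3 - 3 * m41 * m1 ^ 8 + 3 * m41 ^ 2 * m1 ^ 4
                     - 6 * m1 ^ 6 * m31 ^ 2 + 4 * m1 ^ 9 * m31 + 4 * m1 ^ 3 * m31 ^ 3)
                    / (m1 ^ 4 - m41) ^ 3"
proof
  assume "Q \<ge> 2"
  define A where "A = (real Q - 1) * (\<alpha> - \<beta>) ^ 3 / real Q ^ 3"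
  define B where "B = (real Q - 1) * (\<alpha> - \<beta>) ^ 4 / real Q ^ 4"
  have on_four_nodes: "edge_moment n Q \<alpha> \<beta> E = edge_moment 4 Q \<alpha> \<beta> E"
    if "distinct E" "set E \<subseteq> node_pairs 4" for E
    using edge_moment_restrict assms(1-6) that by blast
  have m1: "m1 = \<beta> + (\<alpha> - \<beta>) / Q"
    using assms(8) on_four_nodes[of "[(1,2)]"] edge_moment_single[OF assms(2-6)]
    by (simp add: node_pairs_def)
  have m31: "m31 = m1 ^ 3 + A"
    using assms(9) on_four_nodes[of "[(1,2), (1,3), (2,3)]"] edge_moment_triangle[OF assms(2-6)]
    by (simp add: node_pairs_def m1 A_def)
  have m41: "m41 = m1 ^ 4 + B"
    using assms(10) on_four_nodes[of "[(1,2), (2,3), (3,4), (1,4)]"] edge_moment_square[OF assms(2-6)]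
    by (simp add: node_pairs_def m1 B_def)
  have "A ^ 4 = (real Q - 1) * B ^ 3"
    unfolding A_def B_def by (rule excess_relation)
  moreover have "B \<noteq> 0"
    using \<open>Q \<ge> 2\<close> assms(7) by (simp add: B_def)
  ultimately show "m41 \<noteq> m1 ^ 4 \<and> real Q = (- (m31 ^ 4) - m41 ^ 3 - 3 * m41 * m1 ^ 8
      + 3 * m41 ^ 2 * m1 ^ 4 - 6 * m1 ^ 6 * m31 ^ 2 + 4 * m1 ^ 9 * m31 + 4 * m1 ^ 3 * m31 ^ 3)
      / (m1 ^ 4 - m41) ^ 3"
    using moment_inversion[OF m31 m41] by blast
qed

end
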